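(* Let $\phi$ be any non-negative $C^2$ function with $\phi\not\equiv0$ in $\Omega$ and $\phi=0$ on $\partial\Omega$. Then, for sufficiently large $\lambda$, the quenching time $T$ of the solution to $(P_{\lambda,P})$ satisfies $$T\le\frac{\|\phi\|_1}{3\lambda\|f\phi\|_1-\|\Delta\phi\|_1},$$ where $\|\cdot\|_1$ denotes the $L^1(\Omega)$ norm.
   Context: $\Omega\subset\mathbb{R}^n$ is a bounded domain with smooth boundary, $\lambda>0$, $P>0$. The functions $f,u_0$ are of class $C^2$, $f(x)\ge c_0$ for some constant $c_0>0$, $0\le u_0<1$, and $\Delta u_0+\frac{\lambda f(x)}{(1-u_0)^2}+P\ge 0$ in $\Omega$. Problem $(P_{\lambda,P})$: $u_t-\Delta u=\frac{\lambda f(x)}{(1-u)^2}+P$ in $\Omega\times(0,T)$, $u=0$ on $\partial\Omega\times(0,T)$, $u(x,0)=u_0(x)$ for $x\in\Omega$. The quenching time is $T=\sup\{t>0:\ \|u(\cdot,s)\|_\infty<1\ \forall s\in[0,t]\}$. *)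

theory Defs
  imports "HOL-Analysis.Analysis" "HOL-Probability.Essential_Supremum"
begin

definition partial :: "'n \<Rightarrow> (real ^ 'n \<Rightarrow> real) \<Rightarrow> real ^ 'n \<Rightarrow> real" where
  "partial i g x = deriv (\<lambda>h. g (x + h *\<^sub>R axis i 1)) 0"

definition laplacian :: "(real ^ 'n::finite \<Rightarrow> real) \<Rightarrow> real ^ 'n \<Rightarrow> real" where
  "laplacian g x = (\<Sum>i\<in>UNIV. partial i (partial i g) x)"

text \<open>\<^term>\<open>Ck_on k S g\<close> is meant for open \<open>S\<close>. Differentiability is required explicitly because
  \<^const>\<open>deriv\<close> is total and carries no information where the derivative does not exist; for open
  \<open>S\<close> it also follows from continuity of the (existing) partial derivatives.\<close>

primrec Ck_on :: "nat \<Rightarrow> (real ^ 'n::finite) set \<Rightarrow> (real ^ 'n \<Rightarrow> real) \<Rightarrow> bool" where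
  "Ck_on 0 S g \<longleftrightarrow> continuous_on S g"
| "Ck_on (Suc k) S g \<longleftrightarrow> g differentiable_on S \<and> (\<forall>i. Ck_on k S (partial i g))"

definition extends_cont :: "(real ^ 'n::finite) set \<Rightarrow> (real ^ 'n \<Rightarrow> real) \<Rightarrow> bool" where
  "extends_cont S g \<longleftrightarrow> (\<exists>h. continuous_on (closure S) h \<and> (\<forall>x\<in>S. h x = g x))"

text \<open>The class \<open>C\<^sup>2\<close> up to the boundary: \<open>g\<close> is continuous on the closure, and its derivatives
  of order one and two in \<open>\<Omega>\<close> extend continuously to the closure.\<close>

definition C2_closure :: "(real ^ 'n::finite) set \<Rightarrow> (real ^ 'n \<Rightarrow> real) \<Rightarrow> bool" where
  "C2_closure \<Omega> g \<longleftrightarrow>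
     continuous_on (closure \<Omega>) g \<and> Ck_on 2 \<Omega> g \<and>
     (\<forall>i. extends_cont \<Omega> (partial i g)) \<and>
     (\<forall>i j. extends_cont \<Omega> (partial j (partial i g)))"

text \<open>Smoothness of the boundary is expressed by local defining functions: near each boundary
  point, \<open>\<Omega>\<close> is the set where a smooth function without critical points is negative.\<close>

definition smooth_boundary :: "(real ^ 'n::finite) set \<Rightarrow> bool" where
  "smooth_boundary \<Omega> \<longleftrightarrow>
     (\<forall>p\<in>frontier \<Omega>. \<exists>U \<rho>. open U \<and> p \<in> U \<and> (\<forall>k. Ck_on k U \<rho>) \<and>
        (\<forall>x\<in>U. \<exists>i. partial i \<rho> x \<noteq> 0) \<and> \<Omega> \<inter> U = {x\<in>U. \<rho> x < 0})"

definition smooth_bounded_domain :: "(real ^ 'n::finite) set \<Rightarrow> bool" where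
  "smooth_bounded_domain \<Omega> \<longleftrightarrow>
     open \<Omega> \<and> connected \<Omega> \<and> \<Omega> \<noteq> {} \<and> bounded \<Omega> \<and> smooth_boundary \<Omega>"

definition L1_norm :: "(real ^ 'n::finite) set \<Rightarrow> (real ^ 'n \<Rightarrow> real) \<Rightarrow> real" where
  "L1_norm \<Omega> g = (LINT x|lebesgue_on \<Omega>. \<bar>g x\<bar>)"

definition Linf_norm :: "(real ^ 'n::finite) set \<Rightarrow> (real ^ 'n \<Rightarrow> real) \<Rightarrow> ereal" where
  "Linf_norm \<Omega> g = esssup (lebesgue_on \<Omega>) (\<lambda>x. ereal \<bar>g x\<bar>)"

definition open_times :: "ereal \<Rightarrow> real set" where
  "open_times T = {t. 0 < t \<and> ereal t < T}"

text \<open>\<open>u x t\<close> is twice continuously differentiable in \<open>x\<close> and once in \<open>t\<close>, all these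
  derivatives being jointly continuous on \<open>\<Omega> \<times> J\<close>.\<close>

definition C21_on :: "(real ^ 'n::finite) set \<Rightarrow> real set \<Rightarrow> (real ^ 'n \<Rightarrow> real \<Rightarrow> real) \<Rightarrow> bool" where
  "C21_on \<Omega> J u \<longleftrightarrow>
     (\<forall>t\<in>J. Ck_on 2 \<Omega> (\<lambda>x. u x t)) \<and>
     (\<forall>x\<in>\<Omega>. \<forall>t\<in>J. u x differentiable (at t)) \<and>
     continuous_on (\<Omega> \<times> J) (\<lambda>(x, t). u x t) \<and>
     continuous_on (\<Omega> \<times> J) (\<lambda>(x, t). deriv (u x) t) \<and>
     (\<forall>i. continuous_on (\<Omega> \<times> J) (\<lambda>(x, t). partial i (\<lambda>y. u y t) x)) \<and>
     (\<forall>i j. continuous_on (\<Omega> \<times> J) (\<lambda>(x, t). partial j (partial i (\<lambda>y. u y t)) x))"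

text \<open>Classical solutions on \<open>\<Omega> \<times> (0,T)\<close>, with \<open>T\<close> possibly infinite. Continuity is not required on
  the corner \<open>\<partial>\<Omega> \<times> {0}\<close>, since \<open>u\<^sub>0\<close> is not assumed to vanish on \<open>\<partial>\<Omega>\<close>.\<close>

definition solves_P ::
  "(real ^ 'n::finite) set \<Rightarrow> real \<Rightarrow> real \<Rightarrow> (real ^ 'n \<Rightarrow> real) \<Rightarrow> (real ^ 'n \<Rightarrow> real) \<Rightarrow>
    ereal \<Rightarrow> (real ^ 'n \<Rightarrow> real \<Rightarrow> real) \<Rightarrow> bool" where
  "solves_P \<Omega> lam P f u0 T u \<longleftrightarrow>
     continuous_on (\<Omega> \<times> insert 0 (open_times T) \<union> closure \<Omega> \<times> open_times T) (\<lambda>(x, t). u x t) \<and>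
     C21_on \<Omega> (open_times T) u \<and>
     (\<forall>x\<in>\<Omega>. \<forall>t\<in>open_times T.
        deriv (u x) t - laplacian (\<lambda>y. u y t) x = lam * f x / (1 - u x t)\<^sup>2 + P) \<and>
     (\<forall>x\<in>frontier \<Omega>. \<forall>t\<in>open_times T. u x t = 0) \<and>
     (\<forall>x\<in>\<Omega>. u x 0 = u0 x)"

definition quenching_time :: "(real ^ 'n::finite) set \<Rightarrow> (real ^ 'n \<Rightarrow> real \<Rightarrow> real) \<Rightarrow> ereal" where
  "quenching_time \<Omega> u =
     Sup {ereal t | t. 0 < t \<and> (\<forall>s\<in>{0..t}. Linf_norm \<Omega> (\<lambda>x. u x s) < 1)}"

end

theory Submission
  imports Defs
begin

text \<open>The substitution \<open>w = 1 - (1 - u)\<^sup>3\<close> turns the equation into the differential inequality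
  \<open>w\<^sub>t \<ge> \<Delta>w + 3 \<lambda> f\<close> with \<open>w = 0\<close> on the boundary, and before quenching \<open>0 \<le> w \<le> 1\<close>. The factor \<open>3\<close> in the
  bound comes from the cube. Multiplying by \<open>\<phi>\<close> and integrating by parts twice,
  \<open>d/dt \<integral> \<phi> w \<ge> \<integral> w \<Delta>\<phi> + 3 \<lambda> \<integral> f \<phi> \<ge> 3 \<lambda> \<parallel>f \<phi>\<parallel>\<^sub>1 - \<parallel>\<Delta>\<phi>\<parallel>\<^sub>1\<close>, while \<open>0 \<le> \<integral> \<phi> w \<le> \<parallel>\<phi>\<parallel>\<^sub>1\<close>. A quantity
  in \<open>[0, \<parallel>\<phi>\<parallel>\<^sub>1]\<close> that grows at least at this rate can do so for a time at most the quotient.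

  Two points need care. The derivatives of \<open>u\<close> are not controlled at the boundary, so the
  integration by parts is not available for \<open>\<phi>\<close> itself. Instead, \<open>\<phi>\<close> is replaced by \<open>H(\<phi>)\<close> for a
  convex truncation \<open>H\<close> (lemma \<open>smooth_convex_truncation\<close>), which has compact support; convexity and
  \<open>w \<ge> 0\<close> give the additional term \<open>\<integral> w H''(\<phi>) \<bar>\<nabla>\<phi>\<bar>\<^sup>2\<close> the favourable sign
  (lemma \<open>weighted_growth_truncated\<close>). Integration by parts then only uses that the integral of a
  directional derivative of a compactly supported function is zero
  (lemma \<open>integral_directional_derivative_eq_0\<close>).

  The other point is \<open>u \<ge> 0\<close>. Since \<open>u\<close> may jump at the corner \<open>\<partial>\<Omega> \<times> {0}\<close>, it is derived from a decreasing
  integral of the negative part rather than from a pointwise minimum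
  (lemma \<open>parabolic_minimum_principle\<close>).\<close>

section \<open>Integrals of functions with compact support in an open set\<close>

text \<open>Integrals over \<open>\<Omega>\<close> are moved to a box by extending the integrand by zero. This preserves continuity
  when the integrand already vanishes off a compact subset of \<open>\<Omega>\<close>, and continuity on a box is what the
  Leibniz rule asks for. The support \<open>K\<close> has to be the same for all values of the parameter \<open>t\<close>.\<close>

lemma continuous_on_zero_extension:
  fixes g :: "'a::topological_space \<Rightarrow> 'b::t2_space \<Rightarrow> real"
  assumes "open \<Omega>" "compact K" "K \<subseteq> \<Omega>"
    and cont: "continuous_on (U \<times> \<Omega>) (\<lambda>(t, x). g t x)"
    and zero: "\<And>t x. t \<in> U \<Longrightarrow> x \<in> \<Omega> - K \<Longrightarrow> g t x = 0"
  shows "continuous_on (U \<times> S) (\<lambda>(t, x). if x \<in> \<Omega> then g t x else 0)"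
proof -
  let ?G = "\<lambda>(t, x). if x \<in> \<Omega> then g t x else 0"
  have "closed K" using assms compact_imp_closed by blast
  have 1: "continuous_on (U \<times> \<Omega>) ?G"
    by (rule continuous_on_eq[OF cont]) auto
  have 2: "continuous_on (U \<times> - K) ?G"
    by (rule continuous_on_eq[OF continuous_on_const[of _ "0::real"]]) (use zero in auto)
  have "continuous_on (U \<times> \<Omega> \<union> U \<times> - K) ?G"
  proof (rule continuous_on_Un_local_open[OF _ _ 1 2])
    have "U \<times> \<Omega> = (U \<times> \<Omega> \<union> U \<times> - K) \<inter> (UNIV \<times> \<Omega>)" "U \<times> - K = (U \<times> \<Omega> \<union> U \<times> - K) \<inter> (UNIV \<times> - K)"
      by auto
    then show "openin (top_of_set (U \<times> \<Omega> \<union> U \<times> - K)) (U \<times> \<Omega>)"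
      "openin (top_of_set (U \<times> \<Omega> \<union> U \<times> - K)) (U \<times> - K)"
      using \<open>open \<Omega>\<close> \<open>closed K\<close> by (metis openin_open open_Times open_UNIV open_Compl)+
  qed
  then show ?thesis
    by (rule continuous_on_subset) (use \<open>K \<subseteq> \<Omega>\<close> in auto)
qed

lemma continuous_on_zero_extension_static:
  fixes g :: "'b::t2_space \<Rightarrow> real"
  assumes "open \<Omega>" "compact K" "K \<subseteq> \<Omega>" "continuous_on \<Omega> g"
    and "\<And>x. x \<in> \<Omega> - K \<Longrightarrow> g x = 0"
  shows "continuous_on S (\<lambda>x. if x \<in> \<Omega> then g x else 0)"
proof -
  have "continuous_on ((UNIV :: real set) \<times> S) (\<lambda>(t, x). if x \<in> \<Omega> then g x else 0)"
    by (rule continuous_on_zero_extension[OF assms(1-3)])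
      (use assms in \<open>auto simp: case_prod_unfold intro!: continuous_on_compose2[of \<Omega> g] continuous_intros\<close>)
  then have "continuous_on S ((\<lambda>(t, x). if x \<in> \<Omega> then g x else 0) \<circ> (\<lambda>x. (0::real, x)))"
    by (intro continuous_on_compose continuous_intros) (auto elim!: continuous_on_subset)
  then show ?thesis by (simp add: o_def)
qed

lemma integrable_on_compact_support:
  fixes g :: "'a::euclidean_space \<Rightarrow> real"
  assumes "open \<Omega>" "compact K" "K \<subseteq> \<Omega>" "continuous_on \<Omega> g"
    and "\<And>x. x \<in> \<Omega> - K \<Longrightarrow> g x = 0"
  shows "g integrable_on \<Omega>"
proof -
  obtain c where c: "K \<subseteq> cbox (-c) c"
    using bounded_subset_cbox_symmetric[OF compact_imp_bounded[OF \<open>compact K\<close>]] by metis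
  have "(\<lambda>x. if x \<in> \<Omega> then g x else 0) integrable_on cbox (-c) c"
    by (intro integrable_continuous continuous_on_zero_extension_static[OF assms])
  then have "(\<lambda>x. if x \<in> \<Omega> then g x else 0) integrable_on UNIV"
    by (rule integrable_on_superset) (use c assms(5) in auto)
  then show ?thesis by (simp add: integrable_restrict_UNIV)
qed

lemma has_real_derivative_integral_compact_support:
  fixes g g' :: "real \<Rightarrow> 'a::euclidean_space \<Rightarrow> real"
  assumes \<Omega>: "open \<Omega>" "bounded \<Omega>" and K: "compact K" "K \<subseteq> \<Omega>"
    and U: "convex U" "t0 \<in> U"
    and der: "\<And>t x. t \<in> U \<Longrightarrow> x \<in> \<Omega> \<Longrightarrow> ((\<lambda>s. g s x) has_real_derivative g' t x) (at t within U)"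
    and cont: "\<And>t. t \<in> U \<Longrightarrow> continuous_on \<Omega> (g t)"
    and cont': "continuous_on (U \<times> \<Omega>) (\<lambda>(t, x). g' t x)"
    and zero: "\<And>t x. t \<in> U \<Longrightarrow> x \<in> \<Omega> - K \<Longrightarrow> g t x = 0"
    and zero': "\<And>t x. t \<in> U \<Longrightarrow> x \<in> \<Omega> - K \<Longrightarrow> g' t x = 0"
  shows "((\<lambda>t. integral \<Omega> (g t)) has_real_derivative integral \<Omega> (g' t0)) (at t0 within U)"
proof -
  obtain c where c: "\<Omega> \<subseteq> cbox (-c) c"
    using bounded_subset_cbox_symmetric[OF \<Omega>(2)] by metis
  let ?E = "\<lambda>h x. if x \<in> \<Omega> then h x else (0::real)"
  have eq: "integral (cbox (-c) c) (?E h) = integral \<Omega> h" for h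
    using c by (simp add: Henstock_Kurzweil_Integration.integral_restrict_Int Int_absorb2)
  have "((\<lambda>t. integral (cbox (-c) c) (?E (g t))) has_field_derivative
      integral (cbox (-c) c) (?E (g' t0))) (at t0 within U)"
  proof (rule leibniz_rule_field_derivative[where fx = "\<lambda>t. ?E (g' t)"])
    show "((\<lambda>s. ?E (g s) x) has_field_derivative ?E (g' t) x) (at t within U)" if "t \<in> U" for t x
      using der[OF that, of x] by auto
    show "?E (g t) integrable_on cbox (-c) c" if "t \<in> U" for t
      using that zero by (intro integrable_continuous continuous_on_zero_extension_static[OF \<Omega>(1) K cont]) auto
    show "continuous_on (U \<times> cbox (-c) c) (\<lambda>(t, x). ?E (g' t) x)"
      by (rule continuous_on_zero_extension[OF \<Omega>(1) K cont' zero'])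
  qed (use U in auto)
  then show ?thesis unfolding eq .
qed

text \<open>Translating a compactly supported function does not change its integral, so the derivative of
  the integral along the translations vanishes; by the Leibniz rule it is the integral of the
  directional derivative.\<close>

lemma integral_directional_derivative_eq_0:
  fixes X X' :: "'a::euclidean_space \<Rightarrow> real"
  assumes "open \<Omega>" and K: "compact K" "K \<subseteq> \<Omega>"
    and der: "\<And>x. x \<in> \<Omega> \<Longrightarrow> ((\<lambda>h. X (x + h *\<^sub>R e)) has_real_derivative X' x) (at 0)"
    and cont: "continuous_on \<Omega> X" "continuous_on \<Omega> X'"
    and zero: "\<And>x. x \<in> \<Omega> - K \<Longrightarrow> X x = 0" "\<And>x. x \<in> \<Omega> - K \<Longrightarrow> X' x = 0"
  shows "integral \<Omega> X' = 0"
proof -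
  define Z where "Z = (\<lambda>x. if x \<in> \<Omega> then X x else 0)"
  define Z' where "Z' = (\<lambda>x. if x \<in> \<Omega> then X' x else 0)"
  have contZ: "continuous_on S Z" "continuous_on S Z'" for S
    unfolding Z_def Z'_def
    by (intro continuous_on_zero_extension_static[OF \<open>open \<Omega>\<close> K] cont zero; simp)+
  have out: "Z x = 0" "Z' x = 0" if "x \<notin> K" for x
    using zero that by (auto simp: Z_def Z'_def)
  have op: "open {h. x + h *\<^sub>R e \<in> S}" if "open S" for x S
    using continuous_open_vimage[OF that, of "\<lambda>h. x + h *\<^sub>R e"]
    by (simp add: vimage_def continuous_intros)
  have "open (- K)" using K compact_imp_closed by blast
  have der0: "((\<lambda>h. Z (x + h *\<^sub>R e)) has_real_derivative Z' x) (at 0)" for x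
  proof (cases "x \<in> \<Omega>")
    case True
    have "((\<lambda>h. Z (x + h *\<^sub>R e)) has_real_derivative X' x) (at 0)"
      by (rule has_field_derivative_transform_within_open[OF der[OF True] op[OF \<open>open \<Omega>\<close>]])
        (use True in \<open>auto simp: Z_def\<close>)
    then show ?thesis using True by (simp add: Z'_def)
  next
    case False
    have "((\<lambda>h. Z (x + h *\<^sub>R e)) has_real_derivative 0) (at 0)"
      by (rule has_field_derivative_transform_within_open[OF DERIV_const op[OF \<open>open (- K)\<close>]])
        (use False K out in auto)
    then show ?thesis using False by (simp add: Z'_def)
  qed
  have derh: "((\<lambda>h. Z (x + h *\<^sub>R e)) has_real_derivative Z' (x + h *\<^sub>R e)) (at h)" for x h
    using der0[of "x + h *\<^sub>R e"] DERIV_shift[of "\<lambda>h. Z (x + h *\<^sub>R e)" _ 0 h]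
    by (simp add: algebra_simps)
  obtain R where R: "\<And>x. x \<in> K \<Longrightarrow> norm x \<le> R"
    using compact_imp_bounded[OF K(1)] unfolding bounded_iff by blast
  \<comment> \<open>The box contains every translate of the support by \<open>h e\<close> with \<open>\<bar>h\<bar> \<le> 1\<close>.\<close>
  obtain c where c: "cball 0 (R + norm e) \<subseteq> cbox (-c) (c::'a)"
    using bounded_subset_cbox_symmetric[of "cball 0 (R + norm e)"] bounded_cball by metis
  have far: "x + h *\<^sub>R e \<notin> K" if "x \<notin> cbox (-c) c" "\<bar>h\<bar> \<le> 1" for x h
  proof
    assume "x + h *\<^sub>R e \<in> K"
    have "norm (h *\<^sub>R e) \<le> norm e" using that(2) by (simp add: mult_left_le_one_le)
    moreover have "norm x \<le> norm (x + h *\<^sub>R e) + norm (h *\<^sub>R e)"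
      by (metis add_diff_cancel_right' norm_triangle_ineq4)
    ultimately have "norm x \<le> R + norm e"
      using R[OF \<open>x + h *\<^sub>R e \<in> K\<close>] by linarith
    then show False using that c by auto
  qed
  let ?I = "integral (cbox (-c) c)"
  have const: "?I (\<lambda>x. Z (x + h *\<^sub>R e)) = ?I Z" if "\<bar>h\<bar> \<le> 1" for h
  proof -
    have "(Z has_integral ?I Z) (cbox (-c) c)"
      by (intro integrable_integral integrable_continuous contZ)
    from has_integral_shift_cbox[OF this, of "h *\<^sub>R e"]
    have "((\<lambda>x. Z (x + h *\<^sub>R e)) has_integral ?I Z) UNIV"
      by (rule has_integral_on_superset)
        (use far[of "x + h *\<^sub>R e" 0 for x] out in \<open>auto simp: mem_box algebra_simps\<close>)
    moreover have "((\<lambda>x. Z (x + h *\<^sub>R e)) has_integral ?I (\<lambda>x. Z (x + h *\<^sub>R e))) UNIV"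
    proof (rule has_integral_on_superset)
      show "((\<lambda>x. Z (x + h *\<^sub>R e)) has_integral ?I (\<lambda>x. Z (x + h *\<^sub>R e))) (cbox (-c) c)"
        by (intro integrable_integral integrable_continuous continuous_on_compose2[OF contZ(1)[of UNIV]]
            continuous_intros) auto
    qed (use far that out in auto)
    ultimately show ?thesis by (metis has_integral_unique)
  qed
  have "((\<lambda>h. ?I (\<lambda>x. Z (x + h *\<^sub>R e))) has_field_derivative ?I (\<lambda>x. Z' (x + 0 *\<^sub>R e))) (at 0 within {-1..1})"
  proof (rule leibniz_rule_field_derivative)
    show "continuous_on ({-1..1} \<times> cbox (-c) c) (\<lambda>(h, x). Z' (x + h *\<^sub>R e))"
      unfolding case_prod_unfold
      by (intro continuous_on_compose2[OF contZ(2)[of UNIV]] continuous_intros) auto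
    show "(\<lambda>x. Z (x + h *\<^sub>R e)) integrable_on cbox (-c) c" for h
      by (intro integrable_continuous continuous_on_compose2[OF contZ(1)[of UNIV]] continuous_intros) auto
  qed (auto intro: has_field_derivative_at_within derh)
  then have "((\<lambda>h. ?I Z) has_field_derivative ?I Z') (at 0 within {-1..1})"
    by (rule DERIV_cong[OF has_field_derivative_transform_within[where d = 1]])
     (use const in \<open>auto simp: dist_real_def\<close>)
  then have "((\<lambda>h. ?I Z) has_field_derivative ?I Z') (at 0)"
    using at_within_Icc_at[of "-1" "0::real" 1] by simp
  then have "?I Z' = 0" using DERIV_unique DERIV_const by blast
  moreover have "(Z' has_integral ?I Z') UNIV"
    by (rule has_integral_on_superset[OF integrable_integral[OF integrable_continuous[OF contZ(2)]]])
      (use far[of _ 0] out in auto)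
  ultimately have "(Z' has_integral 0) UNIV" by simp
  then have "(X' has_integral 0) \<Omega>"
    unfolding Z'_def by (simp add: has_integral_restrict_UNIV)
  then show ?thesis by (rule integral_unique)
qed

text \<open>The divergence theorem without its boundary term. Below it takes the place of Green's formula,
  whose boundary integrals involve derivatives of the solution that may not exist there.\<close>

lemma integral_divergence_compact_support:
  fixes X X' :: "'n::finite \<Rightarrow> real ^ 'n \<Rightarrow> real"
  assumes "open \<Omega>" and K: "compact K" "K \<subseteq> \<Omega>"
    and der: "\<And>i x. x \<in> \<Omega> \<Longrightarrow> ((\<lambda>h. X i (x + h *\<^sub>R axis i 1)) has_real_derivative X' i x) (at 0)"
    and cont: "\<And>i. continuous_on \<Omega> (X i)" "\<And>i. continuous_on \<Omega> (X' i)"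
    and zero: "\<And>i x. x \<in> \<Omega> - K \<Longrightarrow> X i x = 0" "\<And>i x. x \<in> \<Omega> - K \<Longrightarrow> X' i x = 0"
  shows "((\<lambda>x. \<Sum>i\<in>UNIV. X' i x) has_integral 0) \<Omega>"
proof -
  have "(X' i has_integral 0) \<Omega>" for i
    using integrable_on_compact_support[OF \<open>open \<Omega>\<close> K cont(2)[of i] zero(2)]
      integral_directional_derivative_eq_0[OF \<open>open \<Omega>\<close> K der[of _ i] cont zero]
    by (metis has_integral_integral)
  then have "((\<lambda>x. \<Sum>i\<in>UNIV. X' i x) has_integral (\<Sum>i\<in>(UNIV::'n set). 0)) \<Omega>"
    by (intro has_integral_sum) auto
  then show ?thesis by simp
qed

section \<open>Classical derivatives, norms and truncations\<close>

lemma has_real_derivative_partial: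
  assumes "open \<Omega>" "g differentiable_on \<Omega>" "x \<in> \<Omega>"
  shows "((\<lambda>h. g (x + h *\<^sub>R axis i 1)) has_real_derivative partial i g x) (at 0)"
proof -
  have "g differentiable (at x)"
    using assms by (metis at_within_open differentiable_on_def)
  then have "g differentiable (at (x + 0 *\<^sub>R axis i 1))" by simp
  moreover have "(\<lambda>h. x + h *\<^sub>R axis i (1::real)) differentiable (at (0::real))"
    by (intro derivative_intros) 
  ultimately have "(\<lambda>h. g (x + h *\<^sub>R axis i 1)) differentiable (at 0)"
    by (rule differentiable_compose)
  then show ?thesis
    unfolding partial_def by (simp add: DERIV_deriv_iff_real_differentiable)
qed

lemma Ck_on_2:
  assumes "open \<Omega>" "Ck_on 2 \<Omega> g"
  shows "g differentiable_on \<Omega>" "partial i g differentiable_on \<Omega>"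
    "continuous_on \<Omega> g" "continuous_on \<Omega> (partial i g)" "continuous_on \<Omega> (partial j (partial i g))"
    "continuous_on \<Omega> (laplacian g)"
proof -
  show 1: "g differentiable_on \<Omega>" "partial i g differentiable_on \<Omega>"
    and "continuous_on \<Omega> (partial j (partial i g))" for i j
    using assms by (auto simp: numeral_2_eq_2)
  then show "continuous_on \<Omega> (laplacian g)"
    unfolding laplacian_def by (intro continuous_intros)
  show "continuous_on \<Omega> g" "continuous_on \<Omega> (partial i g)"
    using 1 differentiable_imp_continuous_on by blast+
qed

lemma absolutely_integrable_on_bounded_continuous:
  fixes g :: "'a::euclidean_space \<Rightarrow> real"
  assumes "open \<Omega>" "bounded \<Omega>" "continuous_on \<Omega> g" "\<And>x. x \<in> \<Omega> \<Longrightarrow> \<bar>g x\<bar> \<le> B"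
  shows "g absolutely_integrable_on \<Omega>"
proof (rule measurable_bounded_by_integrable_imp_absolutely_integrable)
  show "g \<in> borel_measurable (lebesgue_on \<Omega>)"
    using assms by (intro continuous_imp_measurable_on_sets_lebesgue) auto
  show "(\<lambda>x. B) integrable_on \<Omega>"
    using assms lmeasurable_open by (intro integrable_on_const) auto
qed (use assms in auto)

lemma absolutely_integrable_on_extends_cont:
  assumes "open \<Omega>" "bounded \<Omega>" "extends_cont \<Omega> g"
  shows "g absolutely_integrable_on \<Omega>"
proof -
  obtain h where h: "continuous_on (closure \<Omega>) h" "\<And>x. x \<in> \<Omega> \<Longrightarrow> h x = g x"
    using assms by (auto simp: extends_cont_def)
  have "compact (h ` closure \<Omega>)"
    using h assms by (intro compact_continuous_image) (auto simp: compact_closure)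
  then obtain B where B: "\<forall>x\<in>closure \<Omega>. \<bar>h x\<bar> \<le> B"
    by (auto dest!: compact_imp_bounded simp: bounded_iff)
  have "continuous_on \<Omega> h" using h(1) closure_subset continuous_on_subset by blast
  then have "continuous_on \<Omega> g" by (rule continuous_on_eq) (use h in auto)
  moreover have "\<bar>g x\<bar> \<le> B" if "x \<in> \<Omega>" for x
    using B h(2)[OF that] that closure_subset by force
  ultimately show ?thesis
    using assms by (intro absolutely_integrable_on_bounded_continuous)
qed

lemma absolutely_integrable_on_closure_continuous:
  fixes g :: "real ^ 'n::finite \<Rightarrow> real"
  assumes "open \<Omega>" "bounded \<Omega>" "continuous_on (closure \<Omega>) g"
  shows "g absolutely_integrable_on \<Omega>"
  using assms by (intro absolutely_integrable_on_extends_cont) (auto simp: extends_cont_def)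

lemma absolutely_integrable_on_laplacian:
  fixes g :: "real ^ 'n::finite \<Rightarrow> real"
  assumes "open \<Omega>" "bounded \<Omega>" "C2_closure \<Omega> g"
  shows "laplacian g absolutely_integrable_on \<Omega>"
  unfolding laplacian_def using assms
  by (intro absolutely_integrable_sum absolutely_integrable_on_extends_cont)
    (auto simp: C2_closure_def)

lemma L1_norm_eq_integral:
  assumes "open \<Omega>" "g absolutely_integrable_on \<Omega>"
  shows "L1_norm \<Omega> g = integral \<Omega> (\<lambda>x. \<bar>g x\<bar>)"
proof -
  have "(\<lambda>x. \<bar>g x\<bar>) absolutely_integrable_on \<Omega>"
    using assms(2) set_integrable_abs by blast
  then show ?thesis
    unfolding L1_norm_def using assms(1)
    by (intro lebesgue_integral_eq_integral absolutely_integrable_imp_integrable) auto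
qed

lemma continuous_nonneg_integral_le_0_imp_eq_0:
  fixes g :: "'a::euclidean_space \<Rightarrow> real"
  assumes "open \<Omega>" "continuous_on \<Omega> g" "g integrable_on \<Omega>"
    and nonneg: "\<And>x. x \<in> \<Omega> \<Longrightarrow> 0 \<le> g x"
    and "integral \<Omega> g \<le> 0" "x \<in> \<Omega>"
  shows "g x = 0"
proof -
  obtain a b where ab: "x \<in> box a b" "cbox a b \<subseteq> \<Omega>"
    using open_contains_cbox[OF \<open>open \<Omega>\<close> \<open>x \<in> \<Omega>\<close>] by metis
  have cont: "continuous_on (cbox a b) g" using assms ab continuous_on_subset by blast
  have "integral (cbox a b) g \<le> integral \<Omega> g"
    by (intro integral_subset_le) (use assms ab cont integrable_continuous in auto)
  moreover have "0 \<le> integral (cbox a b) g"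
    using ab nonneg by (intro integral_nonneg integrable_continuous cont) auto
  ultimately have "integral (cbox a b) g = 0" using assms by linarith
  then show ?thesis
    using integral_cbox_eq_0_iff[OF cont] ab nonneg box_subset_cbox by blast
qed

text \<open>An open set on which a continuous function exceeds its essential supremum is negligible, hence
  empty; so the bound holds at every point and not just almost everywhere.\<close>

lemma Linf_norm_less_1_imp:
  assumes "open \<Omega>" "continuous_on \<Omega> g" "Linf_norm \<Omega> g < 1" "x \<in> \<Omega>"
  shows "\<bar>g x\<bar> < 1"
proof (rule ccontr)
  assume "\<not> \<bar>g x\<bar> < 1"
  let ?c = "Linf_norm \<Omega> g"
  let ?A = "\<Omega> \<inter> (\<lambda>x. ereal \<bar>g x\<bar>) -` {?c<..}"
  have "open ?A"
    using assms by (intro continuous_open_preimage continuous_intros continuous_on_ereal) auto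
  moreover have "ereal 1 \<le> ereal \<bar>g x\<bar>" using \<open>\<not> \<bar>g x\<bar> < 1\<close> by simp
  then have "?c < ereal \<bar>g x\<bar>" using assms(3) by (metis less_le_trans one_ereal_def)
  then have "?A \<noteq> {}" using \<open>x \<in> \<Omega>\<close> by auto
  moreover have "negligible ?A"
  proof -
    have "AE x in lebesgue_on \<Omega>. ereal \<bar>g x\<bar> \<le> ?c"
      unfolding Linf_norm_def by (rule esssup_AE)
    then have "AE x in lebesgue. x \<in> \<Omega> \<longrightarrow> ereal \<bar>g x\<bar> \<le> ?c"
      using assms(1) by (subst (asm) AE_restrict_space_iff) auto
    then have "{x \<in> space lebesgue. \<not> (x \<in> \<Omega> \<longrightarrow> ereal \<bar>g x\<bar> \<le> ?c)} \<in> null_sets lebesgue"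
      using \<open>open ?A\<close>
      by (subst (asm) AE_iff_null) (auto simp: not_le Int_def vimage_def)
    then show ?thesis
      by (simp add: negligible_iff_null_sets not_le Int_def vimage_def)
  qed
  ultimately show False using open_not_negligible by blast
qed

text \<open>The kink of the positive part is harmless for an outer function that is flat at \<open>0\<close>.\<close>

lemma DERIV_compose_pos_part:
  fixes G G' :: "real \<Rightarrow> real"
  assumes der: "\<And>y. 0 \<le> y \<Longrightarrow> (G has_real_derivative G' y) (at y)" and "G 0 = 0" "G' 0 = 0"
  shows "((\<lambda>s. G (max 0 s)) has_real_derivative G' (max 0 s)) (at s)"
proof -
  consider "s < 0" | "s = 0" | "0 < s" by linarith
  then show ?thesis
  proof cases
    case 1
    have "((\<lambda>s. G (max 0 s)) has_real_derivative 0) (at s)"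
      by (rule has_field_derivative_transform_within_open[OF DERIV_const, of "{..<0}"])
        (use 1 assms in auto)
    then show ?thesis using 1 assms by simp
  next
    case 2
    obtain g where g: "\<And>z. G z = g z * z" "isCont g 0" "g 0 = 0"
      using der[of 0] assms by (auto simp: CARAT_DERIV)
    have "isCont (\<lambda>z. g (max 0 z)) 0"
      by (rule isCont_o2[where g = g]) (use g in \<open>auto intro!: continuous_intros\<close>)
    moreover have "G (max 0 z) = g (max 0 z) * z" for z
      using g by (auto simp: max_def)
    ultimately have "((\<lambda>z. G (max 0 z)) has_real_derivative 0) (at 0)"
      unfolding CARAT_DERIV using g by (intro exI[of _ "\<lambda>z. g (max 0 z)"]) auto
    then show ?thesis using 2 assms by simp
  next
    case 3
    have "((\<lambda>s. G (max 0 s)) has_real_derivative G' s) (at s)"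
      by (rule has_field_derivative_transform_within_open[OF der, of _ "{0<..}"])
        (use 3 in auto)
    then show ?thesis using 3 by simp
  qed
qed

text \<open>A twice continuously differentiable convex substitute for \<open>max 0 (s - \<epsilon>)\<close>. Composed with \<open>\<phi>\<close> it gives a test function with
  compact support. Convexity and \<open>0 \<le> H' \<le> 1\<close> control its Laplacian:
  \<open>\<Delta>(H \<circ> \<phi>) \<ge> H'(\<phi>) \<Delta>\<phi> \<ge> - \<bar>\<Delta>\<phi>\<bar>\<close>. The discarded term \<open>H''(\<phi>) \<bar>\<nabla>\<phi>\<bar>\<^sup>2\<close> need not get small in the mean as
  \<open>\<epsilon> \<rightarrow> 0\<close>: it is what remains of the boundary integral of the normal derivative of \<open>\<phi>\<close>, and
  only its sign is used.\<close>

lemma smooth_convex_truncation: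
  fixes \<epsilon> :: real
  assumes "\<epsilon> > 0"
  obtains H H' H'' :: "real \<Rightarrow> real" where
    "\<And>s. (H has_real_derivative H' s) (at s)" "\<And>s. (H' has_real_derivative H'' s) (at s)"
    "continuous_on UNIV H''" "\<And>s. 0 \<le> H'' s" "\<And>s. 0 \<le> H' s" "\<And>s. H' s \<le> 1"
    "\<And>s. s \<le> \<epsilon> \<Longrightarrow> H s = 0 \<and> H' s = 0 \<and> H'' s = 0"
    "\<And>s. 0 \<le> H s" "\<And>s. 0 \<le> s \<Longrightarrow> H s \<le> s" "\<And>s. s - 3 * \<epsilon> \<le> H s"
proof
  \<comment> \<open>\<open>G\<close> is the primitive of \<open>r\<^sup>2 / (r\<^sup>2 + \<epsilon>\<^sup>2)\<close>, an increasing function from \<open>0\<close> to \<open>1\<close> that is flat at \<open>0\<close>.\<close>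
  define G G' G'' where "G = (\<lambda>r. r - \<epsilon> * arctan (r / \<epsilon>))"
    and "G' = (\<lambda>r. r\<^sup>2 / (r\<^sup>2 + \<epsilon>\<^sup>2))" and "G'' = (\<lambda>r. 2 * r * \<epsilon>\<^sup>2 / (r\<^sup>2 + \<epsilon>\<^sup>2)\<^sup>2)"
  have pos: "0 < r\<^sup>2 + \<epsilon>\<^sup>2" for r using assms by (simp add: add_nonneg_pos)
  have ne: "r\<^sup>2 + \<epsilon>\<^sup>2 \<noteq> 0" "\<epsilon>\<^sup>2 + r\<^sup>2 \<noteq> 0" for r using pos[of r] by auto
  have dG: "(G has_real_derivative G' r) (at r)" for r
    unfolding G_def G'_def
    by (rule derivative_eq_intros refl | use assms ne[of r] in \<open>simp add: field_simps power2_eq_square\<close>)+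
  have dG': "(G' has_real_derivative G'' r) (at r)" for r
    unfolding G'_def G''_def
    by (rule derivative_eq_intros refl ne | use ne[of r] in \<open>simp add: field_simps power2_eq_square\<close>)+
  let ?m = "\<lambda>s. max 0 (s - \<epsilon>)"
  show "((\<lambda>s. G (?m s)) has_real_derivative G' (?m s)) (at s)" for s
    using DERIV_compose_pos_part[OF dG, of "s - \<epsilon>"] DERIV_shift[of "\<lambda>s. G (max 0 s)" _ s "- \<epsilon>"]
    by (simp add: G_def G'_def)
  show "((\<lambda>s. G' (?m s)) has_real_derivative G'' (?m s)) (at s)" for s
    using DERIV_compose_pos_part[OF dG', of "s - \<epsilon>"] DERIV_shift[of "\<lambda>s. G' (max 0 s)" _ s "- \<epsilon>"]
    by (simp add: G'_def G''_def)
  show "continuous_on UNIV (\<lambda>s. G'' (?m s))"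
    unfolding G''_def using ne by (intro continuous_intros) auto
  show "0 \<le> G'' (?m s)" "0 \<le> G' (?m s)" "G' (?m s) \<le> 1" for s
    using pos[of "?m s"] by (auto simp: G''_def G'_def)
  show "G (?m s) = 0 \<and> G' (?m s) = 0 \<and> G'' (?m s) = 0" if "s \<le> \<epsilon>" for s
    using that by (simp add: G_def G'_def G''_def)
  have G0: "0 \<le> G r" if "0 \<le> r" for r
    using arctan_le_self[of "r / \<epsilon>"] that assms by (simp add: G_def field_simps)
  then show "0 \<le> G (?m s)" for s by simp
  have Gr: "G r \<le> r" "r - 2 * \<epsilon> \<le> G r" if "0 \<le> r" for r
  proof -
    have "0 \<le> arctan (r / \<epsilon>)" using that assms by simp
    \<comment> \<open>With \<open>arctan \<le> 2\<close> and the shift by \<open>\<epsilon>\<close>, the loss \<open>s - H s\<close> is at most \<open>3 \<epsilon>\<close>.\<close>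
    moreover have "arctan (r / \<epsilon>) \<le> 2" using arctan_ubound[of "r / \<epsilon>"] pi_less_4 by linarith
    ultimately show "G r \<le> r" "r - 2 * \<epsilon> \<le> G r" using assms by (auto simp: G_def)
  qed
  show "G (?m s) \<le> s" if "0 \<le> s" for s
    using order_trans[OF Gr(1)[of "?m s"], of s] that assms by simp
  show "s - 3 * \<epsilon> \<le> G (?m s)" for s
    using Gr(2)[of "?m s"] assms by (auto simp: max_def G_def split: if_splits)
qed

section \<open>Nonnegativity of bounded supersolutions\<close>

lemma continuous_on_swap_args:
  assumes "continuous_on (A \<times> B) (\<lambda>(x, t). u x t)"
  shows "continuous_on (B \<times> A) (\<lambda>(t, x). u x t)"
proof -
  have "continuous_on (B \<times> A) ((\<lambda>(x, t). u x t) \<circ> prod.swap)"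
    by (intro continuous_on_compose continuous_on_swap) (use assms in \<open>simp add: product_swap\<close>)
  then show ?thesis by (simp add: o_def case_prod_unfold)
qed

lemma continuous_on_slice:
  assumes "continuous_on (A \<times> B) (\<lambda>(x, t). u x t)" "t \<in> B"
  shows "continuous_on A (\<lambda>x. u x t)"
proof -
  have "continuous_on A ((\<lambda>(x, t). u x t) \<circ> (\<lambda>x. (x, t)))"
    by (intro continuous_on_compose continuous_intros continuous_on_subset[OF assms(1)]) (use assms in auto)
  then show ?thesis by (simp add: o_def)
qed

lemma open_times_Icc_subset:
  assumes "0 < s" "t \<in> open_times T"
  shows "{s..t} \<subseteq> open_times T"
  using assms unfolding open_times_def
  by (auto intro: le_less_trans[of "ereal _" "ereal t"])

lemma C21_on_facts:
  assumes "C21_on \<Omega> J u"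
  shows "\<And>t. t \<in> J \<Longrightarrow> Ck_on 2 \<Omega> (\<lambda>x. u x t)"
    "\<And>x t. x \<in> \<Omega> \<Longrightarrow> t \<in> J \<Longrightarrow> (u x has_real_derivative deriv (u x) t) (at t)"
    "continuous_on (\<Omega> \<times> J) (\<lambda>(x, t). u x t)"
    "continuous_on (\<Omega> \<times> J) (\<lambda>(x, t). deriv (u x) t)"
  using assms by (auto simp: C21_on_def DERIV_deriv_iff_real_differentiable)

text \<open>The function \<open>u\<close> need not be continuous at the corner \<open>\<partial>\<Omega> \<times> {0}\<close>, so a minimum over the closed
  cylinder may fail to exist and the pointwise proof of the minimum principle does not start. The
  integral of \<open>E(u)\<close> with \<open>E(y) = max 0 (-\<epsilon> - y) ^ 3\<close> is insensitive to the corner. For a positive time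
  \<open>E(u)\<close> vanishes near the boundary, where \<open>u > -\<epsilon>\<close>, and
  \<open>d/dt \<integral> E(u) \<le> \<integral> E'(u) \<Delta>u = - \<integral> E''(u) \<bar>\<nabla>u\<bar>\<^sup>2 \<le> 0\<close>, because \<open>E' \<le> 0 \<le> E''\<close>. As \<open>t \<rightarrow> 0\<close>,
  dominated convergence with majorant \<open>E(B)\<close> gives \<open>\<integral> E(u) \<rightarrow> \<integral> E(u(\<cdot>, 0)) = 0\<close>. Hence
  \<open>u \<ge> -\<epsilon>\<close> at all times; a negative value of \<open>u\<close> contradicts this for \<open>\<epsilon>\<close> half its size.\<close>

lemma parabolic_minimum_principle:
  fixes u :: "real ^ 'n::finite \<Rightarrow> real \<Rightarrow> real"
  assumes \<Omega>: "open \<Omega>" "bounded \<Omega>"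
    and cont: "continuous_on (\<Omega> \<times> insert 0 (open_times T) \<union> closure \<Omega> \<times> open_times T) (\<lambda>(x, t). u x t)"
    and C21: "C21_on \<Omega> (open_times T) u"
    and super: "\<And>x t. x \<in> \<Omega> \<Longrightarrow> t \<in> open_times T \<Longrightarrow> laplacian (\<lambda>y. u y t) x \<le> deriv (u x) t"
    and boundary: "\<And>x t. x \<in> frontier \<Omega> \<Longrightarrow> t \<in> open_times T \<Longrightarrow> 0 \<le> u x t"
    and initial: "\<And>x. x \<in> \<Omega> \<Longrightarrow> 0 \<le> u x 0"
    and bounded_below: "\<And>x t. x \<in> \<Omega> \<Longrightarrow> t \<in> open_times T \<Longrightarrow> B \<le> u x t"
    and x0: "x0 \<in> \<Omega>" and t: "t \<in> open_times T"
  shows "0 \<le> u x0 t"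
proof (rule ccontr)
  assume "\<not> 0 \<le> u x0 t"
  define \<epsilon> where "\<epsilon> = - u x0 t / 2"
  have \<epsilon>: "0 < \<epsilon>" "u x0 t < - \<epsilon>" using \<open>\<not> 0 \<le> u x0 t\<close> by (auto simp: \<epsilon>_def)
  note C = C21_on_facts[OF C21]
  note D = Ck_on_2[OF \<Omega>(1) C(1)]
  define m where "m = (\<lambda>y::real. max 0 (- \<epsilon> - y))"
  define E E' E'' where "E = (\<lambda>y. m y ^ 3)" and "E' = (\<lambda>y. - 3 * m y ^ 2)" and "E'' = (\<lambda>y. 6 * m y)"
  have dE: "(E has_real_derivative E' y) (at y)" for y
  proof -
    have "((\<lambda>s. max 0 s ^ 3) has_real_derivative 3 * max 0 (- \<epsilon> - y) ^ 2) (at (- \<epsilon> - y))"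
      by (rule DERIV_compose_pos_part[where G = "\<lambda>r. r ^ 3"])
        (auto intro!: derivative_eq_intros)
    moreover have "((\<lambda>y. - \<epsilon> - y) has_real_derivative -1) (at y)"
      by (auto intro!: derivative_eq_intros)
    ultimately have "((\<lambda>y. max 0 (- \<epsilon> - y) ^ 3) has_real_derivative 3 * max 0 (- \<epsilon> - y) ^ 2 * -1) (at y)"
      by (rule DERIV_chain2)
    then show ?thesis by (simp add: E_def E'_def m_def)
  qed
  have dE': "(E' has_real_derivative E'' y) (at y)" for y
  proof -
    have "((\<lambda>s. -3 * max 0 s ^ 2) has_real_derivative -6 * max 0 (- \<epsilon> - y)) (at (- \<epsilon> - y))"
      by (rule DERIV_compose_pos_part[where G = "\<lambda>r. -3 * r ^ 2"])
        (auto intro!: derivative_eq_intros)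
    moreover have "((\<lambda>y. - \<epsilon> - y) has_real_derivative -1) (at y)"
      by (auto intro!: derivative_eq_intros)
    ultimately have "((\<lambda>y. -3 * max 0 (- \<epsilon> - y) ^ 2) has_real_derivative -6 * max 0 (- \<epsilon> - y) * -1) (at y)"
      by (rule DERIV_chain2)
    then show ?thesis by (simp add: E'_def E''_def m_def)
  qed
  have contE: "continuous_on UNIV E" "continuous_on UNIV E'" "continuous_on UNIV E''"
    unfolding E_def E'_def E''_def m_def by (intro continuous_intros)+
  have Epos: "0 \<le> E y" "E' y \<le> 0" "0 \<le> E'' y" for y
    by (auto simp: E_def E'_def E''_def m_def)
  have E0: "E y = 0" "E' y = 0" "E'' y = 0" if "- \<epsilon> \<le> y" for y
    using that by (auto simp: E_def E'_def E''_def m_def)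
  define Y where "Y = (\<lambda>\<tau>. integral \<Omega> (\<lambda>x. E (u x \<tau>)))"
  have Emono: "E y \<le> E z" if "z \<le> y" for y z
    unfolding E_def m_def using that by (intro power_mono) auto
  have cE: "continuous_on \<Omega> (\<lambda>x. E (u x \<tau>))" if "\<tau> \<in> open_times T" for \<tau>
    by (rule continuous_on_compose2[OF contE(1) D(3)[OF that]]) auto
  have iE: "(\<lambda>x. E (u x \<tau>)) integrable_on \<Omega>" if "\<tau> \<in> open_times T" for \<tau>
    using absolutely_integrable_on_bounded_continuous[OF \<Omega> cE[OF that], of "E B"]
      Emono bounded_below[OF _ that] Epos set_lebesgue_integral_eq_integral(1) by force
  have decreasing: "Y t \<le> Y s" if s: "0 < s" "s < t" for s
  proof -
    have J: "{s..t} \<subseteq> open_times T" using open_times_Icc_subset[OF s(1) t] .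
    \<comment> \<open>A support common to all times in \<open>{s..t}\<close>: the projection of the compact set where \<open>u \<le> -\<epsilon>\<close>.\<close>
    define W where "W = (closure \<Omega> \<times> {s..t}) \<inter> (\<lambda>(x, t). u x t) -` {..- \<epsilon>}"
    define K where "K = fst ` W"
    have "closed W" unfolding W_def
      by (rule continuous_closed_preimage)
        (use J in \<open>auto intro!: continuous_on_subset[OF cont] closed_Times\<close>)
    then have "compact W"
      using \<Omega> compact_Int_closed[of "closure \<Omega> \<times> {s..t}" W]
      by (simp add: compact_Times compact_closure W_def Int_absorb1 flip: Int_assoc)
    then have K: "compact K" unfolding K_def by (intro compact_continuous_image continuous_intros)
    have K\<Omega>: "K \<subseteq> \<Omega>"
    proof
      fix x assume "x \<in> K"
      then obtain \<tau> where \<tau>: "\<tau> \<in> {s..t}" "x \<in> closure \<Omega>" "u x \<tau> \<le> - \<epsilon>"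
        by (auto simp: K_def W_def)
      then have "x \<notin> frontier \<Omega>" using boundary[of x \<tau>] J \<epsilon> by auto
      then show "x \<in> \<Omega>" using \<tau> \<Omega>(1) by (auto simp: frontier_def interior_open)
    qed
    have off: "- \<epsilon> \<le> u x \<tau>" if "\<tau> \<in> {s..t}" "x \<in> \<Omega> - K" for x \<tau>
    proof (rule ccontr)
      assume "\<not> - \<epsilon> \<le> u x \<tau>"
      then have "(x, \<tau>) \<in> W" using that closure_subset by (auto simp: W_def)
      then show False using that by (force simp: K_def)
    qed
    define Y' where "Y' = (\<lambda>\<tau>. integral \<Omega> (\<lambda>x. E' (u x \<tau>) * deriv (u x) \<tau>))"
    have cont_u: "continuous_on ({s..t} \<times> \<Omega>) (\<lambda>(\<tau>, x). u x \<tau>)"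
      "continuous_on ({s..t} \<times> \<Omega>) (\<lambda>(\<tau>, x). deriv (u x) \<tau>)"
      by (rule continuous_on_subset[OF continuous_on_swap_args[OF C(3)]], use J in auto)
        (rule continuous_on_subset[OF continuous_on_swap_args[OF C(4)]], use J in auto)
    have cont': "continuous_on ({s..t} \<times> \<Omega>) (\<lambda>(\<tau>, x). E' (u x \<tau>) * deriv (u x) \<tau>)"
      using cont_u unfolding case_prod_unfold
      by (intro continuous_intros continuous_on_compose2[OF contE(2)]) auto
    have dY: "(Y has_real_derivative Y' \<tau>) (at \<tau> within {s..t})" if \<tau>: "\<tau> \<in> {s..t}" for \<tau>
      unfolding Y_def Y'_def
    proof (rule has_real_derivative_integral_compact_support[OF \<Omega> K K\<Omega> _ \<tau> _ _ cont'])
      show "((\<lambda>\<tau>. E (u x \<tau>)) has_real_derivative E' (u x \<tau>) * deriv (u x) \<tau>) (at \<tau> within {s..t})"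
        if "x \<in> \<Omega>" "\<tau> \<in> {s..t}" for \<tau> x
        using DERIV_chain2[OF dE C(2)] that J by (blast intro: has_field_derivative_at_within)
      show "continuous_on \<Omega> (\<lambda>x. E (u x \<tau>))" if "\<tau> \<in> {s..t}" for \<tau>
        using cE that J by blast
    qed (use off E0 in auto)
    have Y'neg: "Y' \<tau> \<le> 0" if \<tau>: "\<tau> \<in> {s..t}" for \<tau>
    proof -
      have \<tau>T: "\<tau> \<in> open_times T" using \<tau> J by auto
      let ?v = "\<lambda>x. u x \<tau>"
      \<comment> \<open>The partial derivatives of the field \<open>E'(u) \<nabla>u\<close>.\<close>
      define X' where "X' = (\<lambda>i x. E'' (?v x) * (partial i ?v x)\<^sup>2 + E' (?v x) * partial i (partial i ?v) x)"
      have div: "((\<lambda>x. \<Sum>i\<in>UNIV. X' i x) has_integral 0) \<Omega>"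
      proof (rule integral_divergence_compact_support[OF \<Omega>(1) K K\<Omega>, where X = "\<lambda>i x. E' (?v x) * partial i ?v x"])
        fix i
        show "((\<lambda>h. E' (?v (x + h *\<^sub>R axis i 1)) * partial i ?v (x + h *\<^sub>R axis i 1)) has_real_derivative X' i x) (at 0)"
          if "x \<in> \<Omega>" for x
        proof -
          have "((\<lambda>h. E' (?v (x + h *\<^sub>R axis i 1))) has_real_derivative E'' (?v x) * partial i ?v x) (at 0)"
            using DERIV_chain2[OF dE' has_real_derivative_partial[OF \<Omega>(1) D(1)[OF \<tau>T] that, of i]] by simp
          from DERIV_mult[OF this has_real_derivative_partial[OF \<Omega>(1) D(2)[OF \<tau>T] that, of i i]]
          show ?thesis by (simp add: X'_def power2_eq_square algebra_simps)
        qed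
        show "continuous_on \<Omega> (\<lambda>x. E' (?v x) * partial i ?v x)" "continuous_on \<Omega> (X' i)"
          unfolding X'_def using D[OF \<tau>T]
          by (intro continuous_intros continuous_on_compose2[OF contE(2)] continuous_on_compose2[OF contE(3)]; simp)+
      qed (use off[OF \<tau>] E0 in \<open>auto simp: X'_def\<close>)
      have "Y' \<tau> \<le> integral \<Omega> (\<lambda>x. \<Sum>i\<in>UNIV. X' i x)"
        unfolding Y'_def
      proof (rule integral_le)
        show "(\<lambda>x. E' (?v x) * deriv (u x) \<tau>) integrable_on \<Omega>"
        proof (rule integrable_on_compact_support[OF \<Omega>(1) K K\<Omega>])
          show "continuous_on \<Omega> (\<lambda>x. E' (?v x) * deriv (u x) \<tau>)"
            using D(3)[OF \<tau>T] continuous_on_slice[OF C(4) \<tau>T]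
            by (intro continuous_intros continuous_on_compose2[OF contE(2)]) auto
        qed (use off[OF \<tau>] E0 in auto)
        show "E' (?v x) * deriv (u x) \<tau> \<le> (\<Sum>i\<in>UNIV. X' i x)" if x: "x \<in> \<Omega>" for x
        proof -
          have "E' (?v x) * deriv (u x) \<tau> \<le> E' (?v x) * laplacian ?v x"
            using super[OF x \<tau>T] Epos(2) by (intro mult_left_mono_neg) auto
          also have "\<dots> = (\<Sum>i\<in>UNIV. E' (?v x) * partial i (partial i ?v) x)"
            by (simp add: laplacian_def sum_distrib_left)
          also have "\<dots> \<le> (\<Sum>i\<in>UNIV. X' i x)"
            using Epos(3) by (intro sum_mono) (simp add: X'_def)
          finally show ?thesis .
        qed
      qed (use div in blast)
      then show ?thesis using div by (simp add: integral_unique)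
    qed
    obtain \<tau> where "\<tau> \<in> {s<..<t}" "Y t - Y s = Y' \<tau> * (t - s)"
      using mvt_simple[OF s(2), of Y "\<lambda>\<tau> h. Y' \<tau> * h"] dY
      by (auto simp: has_field_derivative_def)
    moreover have "Y' \<tau> * (t - s) \<le> 0"
      using Y'neg[of \<tau>] calculation s by (intro mult_nonpos_nonneg) auto
    ultimately show ?thesis by simp
  qed
  have t0: "0 < t" using t by (simp add: open_times_def)
  \<comment> \<open>The shift by \<open>2\<close> makes \<open>s n < t\<close> hold for \<open>n = 0\<close> as well.\<close>
  define s where "s = (\<lambda>n. t / real (n + 2))"
  have s: "0 < s n" "s n < t" for n using t0 by (auto simp: s_def field_simps add_pos_nonneg)
  have sT: "s n \<in> open_times T" for n
    using open_times_Icc_subset[OF s(1)[of n] t] s(2)[of n] by auto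
  have s0: "s \<longlonglongrightarrow> 0" unfolding s_def
    by (rule LIMSEQ_ignore_initial_segment[OF lim_const_over_n])
  have "(\<lambda>n. Y (s n)) \<longlonglongrightarrow> integral \<Omega> (\<lambda>x. 0)"
    unfolding Y_def
  proof (rule dominated_convergence(2))
    show "(\<lambda>x. E (u x (s n))) integrable_on \<Omega>" for n using iE sT by blast
    show "(\<lambda>x. E B) integrable_on \<Omega>"
      using \<Omega> lmeasurable_open by (intro integrable_on_const) auto
    show "norm (E (u x (s n))) \<le> E B" if "x \<in> \<Omega>" for x n
      using Emono[OF bounded_below[OF that sT]] Epos by simp
    show "(\<lambda>n. E (u x (s n))) \<longlonglongrightarrow> 0" if x: "x \<in> \<Omega>" for x
    proof -
      have "continuous_on (insert 0 (open_times T)) ((\<lambda>(x, t). u x t) \<circ> (\<lambda>t. (x, t)))"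
        by (intro continuous_on_compose continuous_intros continuous_on_subset[OF cont]) (use x in auto)
      then have "continuous_on (insert 0 (open_times T)) (\<lambda>\<tau>. E (u x \<tau>))"
        by (intro continuous_on_compose2[OF contE(1)]) (auto simp: o_def)
      then have "(\<lambda>n. E (u x (s n))) \<longlonglongrightarrow> E (u x 0)"
        by (rule continuous_on_tendsto_compose[OF _ s0]) (use sT in auto)
      then show ?thesis using E0(1)[of "u x 0"] initial[OF x] \<epsilon> by simp
    qed
  qed
  then have "(\<lambda>n. Y (s n)) \<longlonglongrightarrow> 0" by simp
  then have "Y t \<le> 0"
    by (rule tendsto_lowerbound) (use decreasing s in auto)
  then have "E (u x0 t) = 0"
    using continuous_nonneg_integral_le_0_imp_eq_0[OF \<Omega>(1) cE[OF t] iE[OF t] Epos(1) _ x0]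
    by (simp add: Y_def)
  then show False using \<epsilon> by (simp add: E_def m_def)
qed

section \<open>The growth of the weighted integral\<close>

text \<open>The substitution \<open>w = 1 - (1 - u)\<^sup>3\<close> removes the singularity: since \<open>3 (1 - u)\<^sup>2\<close> cancels the
  denominator of the nonlinearity,
  \<open>w\<^sub>t = \<Delta>w + 6 (1 - u) \<bar>\<nabla>u\<bar>\<^sup>2 + 3 \<lambda> f + 3 P (1 - u)\<^sup>2 \<ge> \<Delta>w + 3 \<lambda> f\<close>, and \<open>0 \<le> w \<le> 1\<close>. Testing with
  \<open>H(\<phi>)\<close> and moving the Laplacian to it gives
  \<open>d/dt \<integral> H(\<phi>) w \<ge> \<integral> w \<Delta>(H(\<phi>)) + 3 \<lambda> \<integral> f H(\<phi>) \<ge> - \<integral> \<bar>\<Delta>\<phi>\<bar> + 3 \<lambda> \<integral> f H(\<phi>)\<close>, where the last step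
  needs \<open>w \<ge> 0\<close> and the convexity of \<open>H\<close>. Integrating over \<open>{s..t}\<close> and using
  \<open>0 \<le> \<integral> H(\<phi>) w \<le> \<integral> \<phi>\<close> gives the claim, up to the loss \<open>3 \<epsilon>\<close> of the truncation.\<close>

lemma weighted_growth_truncated:
  fixes u :: "real ^ 'n::finite \<Rightarrow> real \<Rightarrow> real"
  assumes \<Omega>: "open \<Omega>" "bounded \<Omega>"
    and C21: "C21_on \<Omega> (open_times T) u"
    and pde: "\<And>x t. x \<in> \<Omega> \<Longrightarrow> t \<in> open_times T \<Longrightarrow>
      deriv (u x) t - laplacian (\<lambda>y. u y t) x = lam * f x / (1 - u x t)\<^sup>2 + P"
    and range: "\<And>x t. x \<in> \<Omega> \<Longrightarrow> t \<in> open_times T \<Longrightarrow> 0 \<le> u x t \<and> u x t < 1"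
    and par: "0 \<le> lam" "0 \<le> P"
    and f: "continuous_on (closure \<Omega>) f" "\<And>x. x \<in> \<Omega> \<Longrightarrow> 0 \<le> f x"
    and \<phi>: "C2_closure \<Omega> \<phi>" "\<And>x. x \<in> \<Omega> \<Longrightarrow> 0 \<le> \<phi> x" "\<And>x. x \<in> frontier \<Omega> \<Longrightarrow> \<phi> x = 0"
    and st: "0 < s" "s < t" "t \<in> open_times T"
    and \<epsilon>: "0 < \<epsilon>"
  shows "(t - s) * (3 * lam * (integral \<Omega> (\<lambda>x. f x * \<phi> x) - 3 * \<epsilon> * integral \<Omega> f)
      - integral \<Omega> (\<lambda>x. \<bar>laplacian \<phi> x\<bar>)) \<le> integral \<Omega> \<phi>"
proof -
  note C = C21_on_facts[OF C21]
  note D = Ck_on_2[OF \<Omega>(1) C(1)]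
  have \<phi>2: "continuous_on (closure \<Omega>) \<phi>" "Ck_on 2 \<Omega> \<phi>"
    using \<phi>(1) by (auto simp: C2_closure_def)
  note D\<phi> = Ck_on_2[OF \<Omega>(1) \<phi>2(2)]
  obtain H H' H'' where
    dH: "\<And>s. (H has_real_derivative H' s) (at s)" "\<And>s. (H' has_real_derivative H'' s) (at s)"
    and H'': "continuous_on UNIV H''" "\<And>s. 0 \<le> H'' s" and H': "\<And>s. 0 \<le> H' s" "\<And>s. H' s \<le> 1"
    and H0: "\<And>s. s \<le> \<epsilon> \<Longrightarrow> H s = 0 \<and> H' s = 0 \<and> H'' s = 0"
    and H: "\<And>s. 0 \<le> H s" "\<And>s. 0 \<le> s \<Longrightarrow> H s \<le> s" "\<And>s. s - 3 * \<epsilon> \<le> H s"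
    using smooth_convex_truncation[OF \<epsilon>] by metis
  have contH: "continuous_on UNIV H" "continuous_on UNIV H'"
    using dH by (meson DERIV_isCont continuous_at_imp_continuous_on)+
  have cf: "continuous_on \<Omega> f" using f(1) closure_subset continuous_on_subset by blast
  have c\<phi>: "continuous_on \<Omega> (\<lambda>x. H (\<phi> x))" "continuous_on \<Omega> (\<lambda>x. H' (\<phi> x))" "continuous_on \<Omega> (\<lambda>x. H'' (\<phi> x))"
    by (intro continuous_on_compose2[OF contH(1) D\<phi>(3)] continuous_on_compose2[OF contH(2) D\<phi>(3)]
      continuous_on_compose2[OF H''(1) D\<phi>(3)]; simp)+
  define K where "K = closure \<Omega> \<inter> \<phi> -` {\<epsilon>..}"
  have "closed K" unfolding K_def by (intro continuous_closed_preimage \<phi>2) auto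
  then have K: "compact K"
    using \<Omega> compact_Int_closed[of "closure \<Omega>" K]
    by (simp add: compact_closure K_def Int_absorb1 flip: Int_assoc)
  have K\<Omega>: "K \<subseteq> \<Omega>"
    using \<phi>(3) \<epsilon> \<Omega>(1) by (force simp: K_def frontier_def interior_open)
  have off: "H (\<phi> x) = 0" "H' (\<phi> x) = 0" "H'' (\<phi> x) = 0" if "x \<in> \<Omega> - K" for x
    using that H0[of "\<phi> x"] closure_subset by (fastforce simp: K_def)+
  have cu: "continuous_on \<Omega> (\<lambda>x. u x \<tau>)" if "\<tau> \<in> open_times T" for \<tau>
    using D(3)[OF that] .
  define w where "w = (\<lambda>y::real. 1 - (1 - y) ^ 3)"
  have dw: "(w has_real_derivative 3 * (1 - y)\<^sup>2) (at y)" for y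
    unfolding w_def by (rule derivative_eq_intros refl | simp)+
  have w01: "0 \<le> w y" "w y \<le> 1" if "0 \<le> y" "y < 1" for y
    using that by (auto simp: w_def power_le_one)
  have contw: "continuous_on UNIV w" unfolding w_def by (intro continuous_intros)
  have cw: "continuous_on \<Omega> (\<lambda>x. w (u x \<tau>))" if "\<tau> \<in> open_times T" for \<tau>
    by (rule continuous_on_compose2[OF contw cu[OF that]]) auto
  have iH: "(\<lambda>x. H (\<phi> x)) integrable_on \<Omega>" "(\<lambda>x. f x * H (\<phi> x)) integrable_on \<Omega>"
    by (intro integrable_on_compact_support[OF \<Omega>(1) K K\<Omega>] continuous_intros c\<phi> cf; simp add: off)+
  have i\<phi>: "\<phi> integrable_on \<Omega>" "f integrable_on \<Omega>" "(\<lambda>x. f x * \<phi> x) integrable_on \<Omega>"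
    by (intro set_lebesgue_integral_eq_integral(1) absolutely_integrable_on_closure_continuous[OF \<Omega>]
      continuous_intros f(1) \<phi>2(1))+
  have iL: "(\<lambda>x. \<bar>laplacian \<phi> x\<bar>) integrable_on \<Omega>"
    using absolutely_integrable_on_laplacian[OF \<Omega> \<phi>(1)]
    by (simp add: absolutely_integrable_on_def)
  define L where "L = integral \<Omega> (\<lambda>x. \<bar>laplacian \<phi> x\<bar>)"
  define F where "F = integral \<Omega> (\<lambda>x. f x * H (\<phi> x))"
  have J: "{s..t} \<subseteq> open_times T" using open_times_Icc_subset[OF st(1,3)] .
  define Y where "Y = (\<lambda>\<tau>. integral \<Omega> (\<lambda>x. H (\<phi> x) * w (u x \<tau>)))"
  define Y' where "Y' = (\<lambda>\<tau>. integral \<Omega> (\<lambda>x. H (\<phi> x) * (3 * (1 - u x \<tau>)\<^sup>2 * deriv (u x) \<tau>)))"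
  have iY: "(\<lambda>x. H (\<phi> x) * w (u x \<tau>)) integrable_on \<Omega>" if "\<tau> \<in> open_times T" for \<tau>
    by (intro integrable_on_compact_support[OF \<Omega>(1) K K\<Omega>] continuous_intros c\<phi> cw that) (simp add: off)
  have dY: "(Y has_real_derivative Y' \<tau>) (at \<tau> within {s..t})" if \<tau>: "\<tau> \<in> {s..t}" for \<tau>
    unfolding Y_def Y'_def
  proof (rule has_real_derivative_integral_compact_support[OF \<Omega> K K\<Omega> _ \<tau>])
    show "((\<lambda>\<tau>. H (\<phi> x) * w (u x \<tau>)) has_real_derivative H (\<phi> x) * (3 * (1 - u x \<tau>)\<^sup>2 * deriv (u x) \<tau>))
        (at \<tau> within {s..t})" if "x \<in> \<Omega>" "\<tau> \<in> {s..t}" for \<tau> x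
    proof -
      have "(u x has_real_derivative deriv (u x) \<tau>) (at \<tau>)" using C(2) that J by auto
      from DERIV_cmult[OF DERIV_chain2[OF dw this]] show ?thesis
        by (rule has_field_derivative_at_within)
    qed
    show "continuous_on \<Omega> (\<lambda>x. H (\<phi> x) * w (u x \<tau>))" if "\<tau> \<in> {s..t}" for \<tau>
      using that J by (intro continuous_intros c\<phi> cw) auto
    have "continuous_on ({s..t} \<times> \<Omega>) (\<lambda>(\<tau>, x). u x \<tau>)"
      "continuous_on ({s..t} \<times> \<Omega>) (\<lambda>(\<tau>, x). deriv (u x) \<tau>)"
      by (rule continuous_on_subset[OF continuous_on_swap_args[OF C(3)]], use J in auto)
        (rule continuous_on_subset[OF continuous_on_swap_args[OF C(4)]], use J in auto)
    then show "continuous_on ({s..t} \<times> \<Omega>) (\<lambda>(\<tau>, x). H (\<phi> x) * (3 * (1 - u x \<tau>)\<^sup>2 * deriv (u x) \<tau>))"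
      unfolding case_prod_unfold
      by (intro continuous_intros continuous_on_compose2[OF c\<phi>(1)]) auto
  qed (use off in auto)
  have growth: "3 * lam * F - L \<le> Y' \<tau>" if \<tau>: "\<tau> \<in> {s..t}" for \<tau>
  proof -
    have \<tau>T: "\<tau> \<in> open_times T" using \<tau> J by auto
    let ?v = "\<lambda>x. u x \<tau>"
    \<comment> \<open>The partial derivatives of the field \<open>H(\<phi>) \<nabla>w - w \<nabla>(H(\<phi>))\<close>; the mixed products cancel.\<close>
    define X' where "X' = (\<lambda>i x. H (\<phi> x) * (3 * (1 - ?v x)\<^sup>2 * partial i (partial i ?v) x - 6 * (1 - ?v x) * (partial i ?v x)\<^sup>2)
      - w (?v x) * (H'' (\<phi> x) * (partial i \<phi> x)\<^sup>2 + H' (\<phi> x) * partial i (partial i \<phi>) x))"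
    have div: "((\<lambda>x. \<Sum>i\<in>UNIV. X' i x) has_integral 0) \<Omega>"
    proof (rule integral_divergence_compact_support[OF \<Omega>(1) K K\<Omega>, where X = "\<lambda>i x.
        H (\<phi> x) * (3 * (1 - ?v x)\<^sup>2 * partial i ?v x) - w (?v x) * (H' (\<phi> x) * partial i \<phi> x)"])
      fix i
      show "((\<lambda>h. H (\<phi> (x + h *\<^sub>R axis i 1)) * (3 * (1 - ?v (x + h *\<^sub>R axis i 1))\<^sup>2 * partial i ?v (x + h *\<^sub>R axis i 1))
          - w (?v (x + h *\<^sub>R axis i 1)) * (H' (\<phi> (x + h *\<^sub>R axis i 1)) * partial i \<phi> (x + h *\<^sub>R axis i 1)))
          has_real_derivative X' i x) (at 0)" if x: "x \<in> \<Omega>" for x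
      proof -
        note p = has_real_derivative_partial[OF \<Omega>(1) D(1)[OF \<tau>T] x, of i]
          has_real_derivative_partial[OF \<Omega>(1) D(2)[OF \<tau>T] x, of i i]
          has_real_derivative_partial[OF \<Omega>(1) D\<phi>(1) x, of i]
          has_real_derivative_partial[OF \<Omega>(1) D\<phi>(2) x, of i i]
        have "((\<lambda>y. 3 * (1 - y)\<^sup>2) has_real_derivative - 6 * (1 - y)) (at y)" for y :: real
          by (rule derivative_eq_intros refl | simp)+
        note q = DERIV_chain2[OF this p(1)]
        note r = DERIV_mult[OF DERIV_chain2[OF dH(1) p(3)] DERIV_mult[OF q p(2)]]
          DERIV_mult[OF DERIV_chain2[OF dw p(1)] DERIV_mult[OF DERIV_chain2[OF dH(2) p(3)] p(4)]]
        show ?thesis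
          using DERIV_diff[OF r] by (simp add: X'_def power2_eq_square algebra_simps)
      qed
      show "continuous_on \<Omega> (\<lambda>x. H (\<phi> x) * (3 * (1 - ?v x)\<^sup>2 * partial i ?v x) - w (?v x) * (H' (\<phi> x) * partial i \<phi> x))"
        "continuous_on \<Omega> (X' i)"
        unfolding X'_def
        by (intro continuous_intros c\<phi> cw[OF \<tau>T] D[OF \<tau>T] D\<phi>)+
    qed (use off in \<open>auto simp: X'_def\<close>)
    let ?R = "\<lambda>x. (\<Sum>i\<in>UNIV. X' i x) + (3 * lam * (f x * H (\<phi> x)) - \<bar>laplacian \<phi> x\<bar>)"
    have R: "(?R has_integral 0 + (3 * lam * F - L)) \<Omega>"
      unfolding F_def L_def using iH(2) iL
      by (intro has_integral_add div has_integral_diff has_integral_mult_right integrable_integral)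
    have "integral \<Omega> ?R \<le> Y' \<tau>"
      unfolding Y'_def
    proof (rule integral_le)
      show "?R integrable_on \<Omega>" using R by blast
      show "(\<lambda>x. H (\<phi> x) * (3 * (1 - ?v x)\<^sup>2 * deriv (u x) \<tau>)) integrable_on \<Omega>"
        by (intro integrable_on_compact_support[OF \<Omega>(1) K K\<Omega>] continuous_intros c\<phi> cu[OF \<tau>T]
            continuous_on_slice[OF C(4) \<tau>T]) (simp add: off)
      show "?R x \<le> H (\<phi> x) * (3 * (1 - ?v x)\<^sup>2 * deriv (u x) \<tau>)" if x: "x \<in> \<Omega>" for x
      proof -
        have v: "0 \<le> ?v x" "?v x < 1" using range[OF x \<tau>T] by auto
        note w = w01[OF v]
        define a where "a = H (\<phi> x) * (3 * (1 - ?v x)\<^sup>2)"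
        define b where "b = w (?v x) * H' (\<phi> x)"
        have a: "0 \<le> a" using H(1) by (simp add: a_def)
        have b: "0 \<le> b" "b \<le> 1" using w H' by (auto simp: b_def mult_le_one)
        have "X' i x \<le> a * partial i (partial i ?v) x - b * partial i (partial i \<phi>) x" for i
        proof -
          have "0 \<le> H (\<phi> x) * (6 * (1 - ?v x) * (partial i ?v x)\<^sup>2)"
            "0 \<le> w (?v x) * (H'' (\<phi> x) * (partial i \<phi> x)\<^sup>2)"
            using H(1) v w H''(2) by (intro mult_nonneg_nonneg; simp)+
          then show ?thesis by (simp add: X'_def a_def b_def algebra_simps)
        qed
        then have "(\<Sum>i\<in>UNIV. X' i x) \<le> (\<Sum>i\<in>UNIV. a * partial i (partial i ?v) x - b * partial i (partial i \<phi>) x)"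
          by (rule sum_mono)
        also have "\<dots> = a * laplacian ?v x - b * laplacian \<phi> x"
          by (simp add: laplacian_def sum_subtractf sum_distrib_left)
        finally have "(\<Sum>i\<in>UNIV. X' i x) \<le> a * laplacian ?v x - b * laplacian \<phi> x" .
        moreover have "\<bar>b * laplacian \<phi> x\<bar> \<le> \<bar>laplacian \<phi> x\<bar>"
          using b by (simp add: abs_mult mult_left_le_one_le)
        ultimately have 1: "(\<Sum>i\<in>UNIV. X' i x) \<le> a * laplacian ?v x + \<bar>laplacian \<phi> x\<bar>" by linarith
        have "H (\<phi> x) * (3 * (1 - ?v x)\<^sup>2 * deriv (u x) \<tau>)
            = a * laplacian ?v x + a * (lam * f x / (1 - ?v x)\<^sup>2 + P)"
          using pde[OF x \<tau>T] by (simp add: a_def flip: distrib_left)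
        also have "a * (lam * f x / (1 - ?v x)\<^sup>2 + P) = 3 * lam * (f x * H (\<phi> x)) + a * P"
          using v by (simp add: a_def field_simps)
        finally show ?thesis using 1 mult_nonneg_nonneg[OF a par(2)] by linarith
      qed
    qed
    then show ?thesis using R by (simp add: integral_unique)
  qed
  obtain \<tau> where \<tau>: "\<tau> \<in> {s<..<t}" "Y t - Y s = Y' \<tau> * (t - s)"
    using mvt_simple[OF st(2), of Y "\<lambda>\<tau> h. Y' \<tau> * h"] dY
    by (auto simp: has_field_derivative_def)
  have "F \<ge> integral \<Omega> (\<lambda>x. f x * \<phi> x - 3 * \<epsilon> * f x)"
    unfolding F_def
  proof (rule integral_le)
    show "(\<lambda>x. f x * \<phi> x - 3 * \<epsilon> * f x) integrable_on \<Omega>"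
      using i\<phi> by (intro integrable_diff integrable_on_mult_right)
    show "f x * \<phi> x - 3 * \<epsilon> * f x \<le> f x * H (\<phi> x)" if "x \<in> \<Omega>" for x
      using mult_left_mono[OF H(3)[of "\<phi> x"] f(2)[OF that]] by (simp add: algebra_simps)
  qed (use iH in auto)
  also have "integral \<Omega> (\<lambda>x. f x * \<phi> x - 3 * \<epsilon> * f x) = integral \<Omega> (\<lambda>x. f x * \<phi> x) - 3 * \<epsilon> * integral \<Omega> f"
    using i\<phi> by (simp add: Henstock_Kurzweil_Integration.integral_diff integrable_on_mult_right)
  finally have "3 * lam * (integral \<Omega> (\<lambda>x. f x * \<phi> x) - 3 * \<epsilon> * integral \<Omega> f) - L \<le> 3 * lam * F - L"
    using par by (simp add: mult_left_mono)
  also have "\<dots> \<le> Y' \<tau>" using growth \<tau> by simp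
  finally have "(t - s) * (3 * lam * (integral \<Omega> (\<lambda>x. f x * \<phi> x) - 3 * \<epsilon> * integral \<Omega> f) - L) \<le> Y t - Y s"
    using st \<tau> by (simp add: mult.commute mult_left_mono)
  also have "\<dots> \<le> Y t"
  proof -
    have sT: "s \<in> open_times T" using J st by auto
    have "0 \<le> Y s"
      unfolding Y_def
    proof (rule integral_nonneg[OF iY[OF sT]])
      show "0 \<le> H (\<phi> x) * w (u x s)" if "x \<in> \<Omega>" for x
        using H(1) w01(1) range[OF that sT] by simp
    qed
    then show ?thesis by simp
  qed
  also have "Y t \<le> integral \<Omega> \<phi>"
    unfolding Y_def
  proof (rule integral_le[OF iY[OF st(3)] i\<phi>(1)])
    fix x assume x: "x \<in> \<Omega>"
    have "H (\<phi> x) * w (u x t) \<le> H (\<phi> x)"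
      using w01 range[OF x st(3)] H(1) by (intro mult_left_le) auto
    then show "H (\<phi> x) * w (u x t) \<le> \<phi> x" using H(2)[OF \<phi>(2)[OF x]] by linarith
  qed
  finally show ?thesis by (simp add: L_def)
qed

text \<open>One sequence \<open>e\<^sub>n \<rightarrow> 0\<close> serves both as the initial time \<open>s\<close> and as the truncation level \<open>\<epsilon>\<close>.\<close>

lemma existence_time_bound:
  fixes u :: "real ^ 'n::finite \<Rightarrow> real \<Rightarrow> real"
  assumes \<Omega>: "open \<Omega>" "bounded \<Omega>"
    and C21: "C21_on \<Omega> (open_times T) u"
    and pde: "\<And>x t. x \<in> \<Omega> \<Longrightarrow> t \<in> open_times T \<Longrightarrow>
      deriv (u x) t - laplacian (\<lambda>y. u y t) x = lam * f x / (1 - u x t)\<^sup>2 + P"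
    and range: "\<And>x t. x \<in> \<Omega> \<Longrightarrow> t \<in> open_times T \<Longrightarrow> 0 \<le> u x t \<and> u x t < 1"
    and par: "0 \<le> lam" "0 \<le> P"
    and f: "continuous_on (closure \<Omega>) f" "\<And>x. x \<in> \<Omega> \<Longrightarrow> 0 \<le> f x"
    and \<phi>: "C2_closure \<Omega> \<phi>" "\<And>x. x \<in> \<Omega> \<Longrightarrow> 0 \<le> \<phi> x" "\<And>x. x \<in> frontier \<Omega> \<Longrightarrow> \<phi> x = 0"
    and t: "t \<in> open_times T"
  shows "t * (3 * lam * integral \<Omega> (\<lambda>x. f x * \<phi> x) - integral \<Omega> (\<lambda>x. \<bar>laplacian \<phi> x\<bar>)) \<le> integral \<Omega> \<phi>"
proof -
  let ?e = "\<lambda>n. t / real (n + 2)"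
  have "0 < t" using t by (simp add: open_times_def)
  then have e: "0 < ?e n" "?e n < t" for n by (auto simp: field_simps add_pos_nonneg)
  have lim: "?e \<longlonglongrightarrow> 0"
    by (rule LIMSEQ_ignore_initial_segment[OF lim_const_over_n])
  let ?g = "\<lambda>e. (t - e) * (3 * lam * (integral \<Omega> (\<lambda>x. f x * \<phi> x) - 3 * e * integral \<Omega> f)
      - integral \<Omega> (\<lambda>x. \<bar>laplacian \<phi> x\<bar>))"
  have "(\<lambda>n. ?g (?e n)) \<longlonglongrightarrow> ?g 0"
    by (intro tendsto_intros lim)
  moreover have "?g (?e n) \<le> integral \<Omega> \<phi>" for n
    by (rule weighted_growth_truncated[OF \<Omega> C21 pde range par f \<phi> e t e(1)])
  ultimately have "?g 0 \<le> integral \<Omega> \<phi>"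
    by (rule lim_mono[OF _ _ tendsto_const, rotated]) 
  then show ?thesis by simp
qed

section \<open>The bound for the quenching time\<close>

text \<open>A \<open>lam\<close> above \<open>lam0\<close> makes the denominator positive. Such a threshold exists because \<open>f \<ge> c0 > 0\<close> and
  \<open>\<phi>\<close> is continuous, nonnegative and not identically zero, so that \<open>\<parallel>f \<phi>\<parallel>\<^sub>1 > 0\<close>. Every time \<open>t\<close> before
  quenching satisfies the bound, and so does their supremum.\<close>

theorem proposition1p3:
  fixes \<Omega> :: "(real ^ 'n::finite) set"
    and f u0 \<phi> :: "real ^ 'n \<Rightarrow> real"
    and P c0 :: real
  assumes dom: "smooth_bounded_domain \<Omega>"
    and P: "P > 0"
    and f: "C2_closure \<Omega> f" "c0 > 0" "\<And>x. x \<in> \<Omega> \<Longrightarrow> f x \<ge> c0"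
    and u0: "C2_closure \<Omega> u0" "\<And>x. x \<in> \<Omega> \<Longrightarrow> 0 \<le> u0 x \<and> u0 x < 1"
    and phi: "C2_closure \<Omega> \<phi>" "\<And>x. x \<in> \<Omega> \<Longrightarrow> \<phi> x \<ge> 0" "\<exists>x\<in>\<Omega>. \<phi> x \<noteq> 0"
      "\<And>x. x \<in> frontier \<Omega> \<Longrightarrow> \<phi> x = 0"
  shows "\<exists>lam0>0. \<forall>lam>lam0.
           (\<forall>x\<in>\<Omega>. laplacian u0 x + lam * f x / (1 - u0 x)\<^sup>2 + P \<ge> 0) \<longrightarrow>
           (\<forall>u. solves_P \<Omega> lam P f u0 (quenching_time \<Omega> u) u \<longrightarrow>
              quenching_time \<Omega> u \<le>
                ereal (L1_norm \<Omega> \<phi> /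
                  (3 * lam * L1_norm \<Omega> (\<lambda>x. f x * \<phi> x) - L1_norm \<Omega> (laplacian \<phi>))))"
proof -
  have \<Omega>: "open \<Omega>" "bounded \<Omega>" using dom by (auto simp: smooth_bounded_domain_def)
  have cf: "continuous_on (closure \<Omega>) f" and c\<phi>: "continuous_on (closure \<Omega>) \<phi>"
    using f phi by (auto simp: C2_closure_def)
  have f0: "0 \<le> f x" if "x \<in> \<Omega>" for x using f(2) f(3)[OF that] by linarith
  define N where "N = integral \<Omega> (\<lambda>x. f x * \<phi> x)"
  define L where "L = integral \<Omega> (\<lambda>x. \<bar>laplacian \<phi> x\<bar>)"
  have cf\<phi>: "continuous_on (closure \<Omega>) (\<lambda>x. f x * \<phi> x)" by (intro continuous_intros cf c\<phi>)
  note abs = absolutely_integrable_on_closure_continuous[OF \<Omega>]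
  have norms: "L1_norm \<Omega> \<phi> = integral \<Omega> \<phi>" "L1_norm \<Omega> (\<lambda>x. f x * \<phi> x) = N"
    "L1_norm \<Omega> (laplacian \<phi>) = L"
    using L1_norm_eq_integral[OF \<Omega>(1)] abs c\<phi> cf\<phi> absolutely_integrable_on_laplacian[OF \<Omega> phi(1)]
      phi(2) f0
    by (auto simp: N_def L_def intro!: Henstock_Kurzweil_Integration.integral_cong)
  have L0: "0 \<le> L" unfolding L_def using absolutely_integrable_on_laplacian[OF \<Omega> phi(1)]
    by (intro integral_nonneg) (auto simp: absolutely_integrable_on_def)
  have \<phi>0: "0 \<le> integral \<Omega> \<phi>"
    using phi(2) abs[OF c\<phi>] by (intro integral_nonneg) (auto simp: absolutely_integrable_on_def)
  have "0 < N"
  proof (rule ccontr)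
    assume "\<not> 0 < N"
    obtain x where x: "x \<in> \<Omega>" "\<phi> x \<noteq> 0" using phi(3) by blast
    have "f x * \<phi> x = 0"
      by (rule continuous_nonneg_integral_le_0_imp_eq_0[OF \<Omega>(1) continuous_on_subset[OF cf\<phi> closure_subset]])
        (use abs[OF cf\<phi>] \<open>\<not> 0 < N\<close> x phi(2) f0 in \<open>auto simp: N_def absolutely_integrable_on_def\<close>)
    then show False using x f(2) f(3)[OF x(1)] by auto
  qed
  \<comment> \<open>With the summand \<open>1\<close>, \<open>lam0 > 0\<close> follows from \<open>L \<ge> 0\<close> alone.\<close>
  define lam0 where "lam0 = (L + 1) / (3 * N)"
  have "0 < lam0" using \<open>0 < N\<close> L0 by (simp add: lam0_def)
  moreover have "quenching_time \<Omega> u \<le> ereal (integral \<Omega> \<phi> / (3 * lam * N - L))"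
    if lam: "lam > lam0" and sol: "solves_P \<Omega> lam P f u0 (quenching_time \<Omega> u) u" for lam u
  proof -
    let ?T = "quenching_time \<Omega> u"
    have den: "0 < 3 * lam * N - L"
      using lam \<open>0 < N\<close> by (simp add: lam0_def field_simps)
    have lam_pos: "0 < lam" using lam \<open>0 < lam0\<close> by linarith
    have C21: "C21_on \<Omega> (open_times ?T) u"
      and cont: "continuous_on (\<Omega> \<times> insert 0 (open_times ?T) \<union> closure \<Omega> \<times> open_times ?T) (\<lambda>(x, t). u x t)"
      and pde: "\<And>x t. x \<in> \<Omega> \<Longrightarrow> t \<in> open_times ?T \<Longrightarrow>
        deriv (u x) t - laplacian (\<lambda>y. u y t) x = lam * f x / (1 - u x t)\<^sup>2 + P"
      and bdry: "\<And>x t. x \<in> frontier \<Omega> \<Longrightarrow> t \<in> open_times ?T \<Longrightarrow> u x t = 0"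
      and init: "\<And>x. x \<in> \<Omega> \<Longrightarrow> u x 0 = u0 x"
      using sol by (auto simp: solves_P_def)
    have below1: "\<bar>u x t\<bar> < 1" if x: "x \<in> \<Omega>" and t: "t \<in> open_times ?T" for x t
    proof -
      have "0 < t" "ereal t < ?T" using t by (auto simp: open_times_def)
      then obtain t' where "t < t'" "\<forall>s\<in>{0..t'}. Linf_norm \<Omega> (\<lambda>x. u x s) < 1"
        unfolding quenching_time_def less_Sup_iff by auto
      then have "Linf_norm \<Omega> (\<lambda>x. u x t) < 1" using \<open>0 < t\<close> by auto
      then show ?thesis
        using Linf_norm_less_1_imp[OF \<Omega>(1) Ck_on_2(3)[OF \<Omega>(1) C21_on_facts(1)[OF C21 t]] _ x] by blast
    qed
    have super: "laplacian (\<lambda>y. u y t) x \<le> deriv (u x) t" if "x \<in> \<Omega>" "t \<in> open_times ?T" for x t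
    proof -
      have "0 \<le> lam * f x / (1 - u x t)\<^sup>2 + P"
        using lam_pos f0[OF that(1)] P by simp
      then show ?thesis using pde[OF that] by linarith
    qed
    have nonneg: "0 \<le> u x t" if "x \<in> \<Omega>" "t \<in> open_times ?T" for x t
    proof (rule parabolic_minimum_principle[OF \<Omega> cont C21 super _ _ _ that])
      show "- 1 \<le> u x t" if "x \<in> \<Omega>" "t \<in> open_times ?T" for x t
        using below1[OF that] by linarith
    qed (use bdry init u0 in auto)
    have bound: "t \<le> integral \<Omega> \<phi> / (3 * lam * N - L)" if t: "t \<in> open_times ?T" for t
    proof -
      have "t * (3 * lam * N - L) \<le> integral \<Omega> \<phi>"
        unfolding N_def L_def
        by (rule existence_time_bound[OF \<Omega> C21 pde _ _ _ cf f0 phi(1,2,4) t])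
          (use nonneg below1 lam_pos P in \<open>auto simp: abs_less_iff\<close>)
      then show ?thesis using den by (simp add: pos_le_divide_eq)
    qed
    \<comment> \<open>This also covers \<open>?T = -\<infinity>\<close>, the value of the supremum of the empty set.\<close>
    show ?thesis
    proof (rule ccontr)
      assume "\<not> ?T \<le> ereal (integral \<Omega> \<phi> / (3 * lam * N - L))"
      then obtain r where r: "integral \<Omega> \<phi> / (3 * lam * N - L) < r" "ereal r < ?T"
        by (metis ereal_dense2 less_ereal.simps(1) not_le)
      moreover have "0 \<le> integral \<Omega> \<phi> / (3 * lam * N - L)" using \<phi>0 den by simp
      ultimately have "r \<in> open_times ?T" by (simp add: open_times_def)
      then show False using bound r(1) by force
    qed
  qed
  ultimately show ?thesis unfolding norms by blast
qed


end
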